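(* For every integer $n\ge0$, \[ B_{n,\lambda}(x,y)=e_\lambda^{y-1}(x)\sum_{k=0}^{n}{n\brace k}_\lambda(y)_{k,\lambda}\Big(\frac{x}{1+\lambda x}\Big)^k . \] When $y=1$, \[ B_{n,\lambda}(x,1)=\sum_{k=0}^{n}{n\brace k}_\lambda(1)_{k,\lambda}\Big(\frac{x}{1+\lambda x}\Big)^k=B_{n,\lambda}(x). \]
   Context: Let $\lambda$ be a fixed nonzero real number. The degenerate falling factorial is $(x)_{0,\lambda}=1$ and $(x)_{n,\lambda}=x(x-\lambda)\cdots(x-(n-1)\lambda)$ for $n\ge1$. The degenerate exponential is $e_\lambda^{x}(t)=(1+\lambda t)^{x/\lambda}=\sum_{n\ge0}(x)_{n,\lambda}\frac{t^n}{n!}$, and $e_\lambda(t)=e_\lambda^1(t)$. The degenerate Stirling numbers of the second kind ${n\brace k}_\lambda$ are defined by $\frac{1}{k!}(e_\lambda(t)-1)^k=\sum_{n\ge k}{n\brace k}_\lambda\frac{t^n}{n!}$ for $k\ge0$. Let $x,y$ be real with $1+\lambda x>0$. The fully degenerate Bell polynomials $B_{n,\lambda}(x)$ and the two variable fully degenerate Bell polynomials $B_{n,\lambda}(x,y)$ are defined by the formal power series identities in $t$ \[ \frac{e_\lambda(xe_\lambda(t))}{e_\lambda(x)}=\sum_{n\ge0}B_{n,\lambda}(x)\frac{t^n}{n!},\qquad \frac{e^{y}_\lambda(xe_\lambda(t))}{e_\lambda(x)}=\sum_{n\ge0}B_{n,\lambda}(x,y)\frac{t^n}{n!}, \] where $e_\lambda^{y}(xe_\lambda(t))=(1+\lambda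 x e_\lambda(t))^{y/\lambda}$ and $e_\lambda^{y}(x)=(1+\lambda x)^{y/\lambda}$. *)

theory Defs
  imports "HOL-Analysis.Analysis"
begin

definition degen_ffact :: "real \<Rightarrow> real \<Rightarrow> nat \<Rightarrow> real" where
  "degen_ffact lam x n = (\<Prod>i<n. x - real i * lam)"

(* Real power of a formal power series F with constant term c > 0:
     F^a = c^a * (1 + G)^a   with   G = F/c - 1,
   where (1 + G)^a is the binomial series, meaningful since G has constant term 0.
   The lemmas below show that F^a is the series with constant term c^a satisfying
   F * (F^a)' = a * F' * F^a, and that it agrees with ordinary powers. *)
definition fps_powr :: "real fps \<Rightarrow> real \<Rightarrow> real fps" where
  "fps_powr F a =
     fps_const (fps_nth F 0 powr a) *
     (fps_binomial a oo (fps_const (1 / fps_nth F 0) * F - 1))"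

lemma fps_powr_nth_0: "fps_nth (fps_powr F a) 0 = fps_nth F 0 powr a"
  by (simp add: fps_powr_def)

lemma fps_powr_deriv:
  assumes "fps_nth F 0 > 0"
  shows "F * fps_deriv (fps_powr F a) = fps_const a * fps_deriv F * fps_powr F a"
proof -
  define c where "c = fps_nth F 0"
  define G where "G = fps_const (1 / c) * F - 1"
  define H where "H = fps_binomial a oo G"
  have c: "c > 0" using assms by (simp add: c_def)
  have G0: "fps_nth G 0 = 0" using c by (simp add: G_def c_def)
  have F: "F = fps_const c * (1 + G)"
    using c by (simp add: G_def mult.assoc [symmetric])
  have dF: "fps_deriv F = fps_const c * fps_deriv G"
    by (subst F) simp
  have unit: "fps_nth (1 + fps_X :: real fps) 0 \<noteq> 0" by simp
  have "(1 + fps_X) * fps_deriv (fps_binomial a) = fps_const a * fps_binomial a"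
    unfolding fps_binomial_deriv
    by (subst fps_divide_unit [OF unit])
       (use inverse_mult_eq_1' [OF unit] in \<open>simp add: mult_ac\<close>)
  then have "((1 + fps_X) * fps_deriv (fps_binomial a)) oo G = (fps_const a * fps_binomial a) oo G"
    by simp
  then have K: "(1 + G) * (fps_deriv (fps_binomial a) oo G) = fps_const a * H"
    using G0 by (simp add: fps_compose_mult_distrib fps_compose_add_distrib H_def)
  have dH: "fps_deriv H = (fps_deriv (fps_binomial a) oo G) * fps_deriv G"
    using G0 by (simp add: H_def fps_compose_deriv)
  have P: "fps_powr F a = fps_const (c powr a) * H"
    by (simp add: fps_powr_def H_def G_def c_def)
  have "F * fps_deriv (fps_powr F a) =
      fps_const c * fps_const (c powr a) * fps_deriv G *
      ((1 + G) * (fps_deriv (fps_binomial a) oo G))"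
    unfolding P fps_deriv_mult_const_left dH by (subst F) (simp only: mult_ac)
  also have "\<dots> = fps_const a * fps_deriv F * fps_powr F a"
    by (simp only: K dF P mult_ac)
  finally show ?thesis .
qed

lemma fps_powr_of_nat:
  assumes "fps_nth F 0 > 0"
  shows "fps_powr F (of_nat n) = F ^ n"
proof -
  define c where "c = fps_nth F 0"
  define G where "G = fps_const (1 / c) * F - 1"
  have c: "c > 0" using assms by (simp add: c_def)
  have G0: "fps_nth G 0 = 0" using c by (simp add: G_def c_def)
  have F: "F = fps_const c * (1 + G)"
    using c by (simp add: G_def mult.assoc [symmetric])
  have "fps_powr F (of_nat n) = fps_const (c ^ n) * ((1 + fps_X) ^ n oo G)"
    using c by (simp add: fps_powr_def G_def c_def powr_realpow fps_binomial_of_nat)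
  also have "(1 + fps_X) ^ n oo G = (1 + G) ^ n"
    using G0 by (simp add: fps_compose_power [symmetric] fps_compose_add_distrib)
  also have "fps_const (c ^ n) * (1 + G) ^ n = F ^ n"
    by (subst F) (simp add: power_mult_distrib fps_const_power)
  finally show ?thesis .
qed

definition degen_exp :: "real \<Rightarrow> real \<Rightarrow> real \<Rightarrow> real" where
  "degen_exp lam y u = (1 + lam * u) powr (y / lam)"

definition degen_exp_fps :: "real \<Rightarrow> real \<Rightarrow> real fps \<Rightarrow> real fps" where
  "degen_exp_fps lam y F = fps_powr (1 + fps_const lam * F) (y / lam)"

lemma degen_exp_fps_X:
  assumes "lam \<noteq> 0"
  shows "degen_exp_fps lam y fps_X = Abs_fps (\<lambda>n. degen_ffact lam y n / fact n)"
proof (rule fps_ext)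
  fix n
  have "fps_nth (degen_exp_fps lam y fps_X) n = lam ^ n * ((y / lam) gchoose n)"
    by (simp add: degen_exp_fps_def fps_powr_def fps_compose_linear)
  also have "\<dots> = (\<Prod>i<n. lam * (y / lam - real i)) / fact n"
    by (simp add: gbinomial_prod_rev prod.distrib atLeast0LessThan)
  also have "(\<Prod>i<n. lam * (y / lam - real i)) = degen_ffact lam y n"
    unfolding degen_ffact_def using assms by (intro prod.cong) (auto simp: field_simps)
  finally show "fps_nth (degen_exp_fps lam y fps_X) n =
      fps_nth (Abs_fps (\<lambda>n. degen_ffact lam y n / fact n)) n" by simp
qed

definition degen_stirling2 :: "real \<Rightarrow> nat \<Rightarrow> nat \<Rightarrow> real" where
  "degen_stirling2 lam n k =
     fact n * fps_nth (fps_const (1 / fact k) * (degen_exp_fps lam 1 fps_X - 1) ^ k) n"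

definition fdegen_bell :: "real \<Rightarrow> nat \<Rightarrow> real \<Rightarrow> real" where
  "fdegen_bell lam n x =
     fact n * fps_nth (degen_exp_fps lam 1 (fps_const x * degen_exp_fps lam 1 fps_X)
                       / fps_const (degen_exp lam 1 x)) n"

definition fdegen_bell2 :: "real \<Rightarrow> nat \<Rightarrow> real \<Rightarrow> real \<Rightarrow> real" where
  "fdegen_bell2 lam n x y =
     fact n * fps_nth (degen_exp_fps lam y (fps_const x * degen_exp_fps lam 1 fps_X)
                       / fps_const (degen_exp lam 1 x)) n"

end

theory Submission
  imports Defs
begin

text \<open>With \<open>c = 1 + \<lambda>x\<close>, the inner series is
  \<open>1 + \<lambda>x e\<^sub>\<lambda>(t) = c (1 + (\<lambda>x / c) (e\<^sub>\<lambda>(t) - 1))\<close>, so its power \<open>y / \<lambda>\<close> is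
  \<open>c\<close> to the \<open>y / \<lambda>\<close> times a binomial series in \<open>e\<^sub>\<lambda>(t) - 1\<close>, whose powers generate the
  degenerate Stirling numbers.\<close>

text \<open>Compares two readings of the same coefficient of
  \<open>degen_exp_fps lam y fps_X\<close>: the one in \<open>degen_exp_fps_X\<close> and the
  binomial series at \<open>lam * t\<close>.\<close>

lemma degen_ffact_eq_gbinomial:
  assumes "lam \<noteq> 0"
  shows "degen_ffact lam y n = fact n * lam ^ n * ((y / lam) gchoose n)"
proof -
  have "fps_nth (degen_exp_fps lam y fps_X) n = lam ^ n * ((y / lam) gchoose n)"
    by (simp add: degen_exp_fps_def fps_powr_def fps_compose_linear)
  then show ?thesis
    using assms by (simp add: degen_exp_fps_X field_simps)
qed

lemma degen_stirling2_eq: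
  "degen_stirling2 lam n k =
     fact n / fact k * fps_nth ((degen_exp_fps lam 1 fps_X - 1) ^ k) n"
  by (simp add: degen_stirling2_def)

lemma degen_exp_diff:
  assumes "1 + lam * x > 0"
  shows "degen_exp lam y x / degen_exp lam z x = degen_exp lam (y - z) x"
  using assms by (simp add: degen_exp_def powr_diff diff_divide_distrib)

text \<open>The numerator of the generating function, before division by
  \<open>degen_exp lam 1 x\<close>. The sum stops at \<open>n\<close> because
  \<open>(E - 1) ^ k\<close> has no terms below degree \<open>k\<close>.\<close>

lemma degen_exp_fps_compose_nth:
  assumes "lam \<noteq> 0" and "1 + lam * x > 0"
  shows "fact n * fps_nth (degen_exp_fps lam y (fps_const x * degen_exp_fps lam 1 fps_X)) n =
    degen_exp lam y x *
    (\<Sum>k=0..n. degen_stirling2 lam n k * degen_ffact lam y k * (x / (1 + lam * x)) ^ k)"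
proof -
  define c where "c = 1 + lam * x"
  define E where "E = degen_exp_fps lam 1 fps_X"
  have c: "c > 0" using assms by (simp add: c_def)
  have E0: "fps_nth E 0 = 1"
    using assms by (simp add: E_def degen_exp_fps_X degen_ffact_def)
  have F0: "fps_nth (1 + fps_const lam * (fps_const x * E)) 0 = c"
    by (simp add: E0 c_def)
  \<comment> \<open>This is the series that \<open>fps_powr\<close> substitutes into the binomial
    series. Only the constant coefficient is special: it vanishes on both sides, by the choice of
    \<open>c\<close>.\<close>
  have G: "fps_const (1 / c) * (1 + fps_const lam * (fps_const x * E)) - 1 =
      fps_const (lam * x / c) * (E - 1)"
  proof (rule fps_ext)
    fix m
    show "fps_nth (fps_const (1 / c) * (1 + fps_const lam * (fps_const x * E)) - 1) m =
        fps_nth (fps_const (lam * x / c) * (E - 1)) m"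
      using c by (cases "m = 0") (auto simp: E0 c_def field_simps)
  qed
  have "fact n * fps_nth (degen_exp_fps lam y (fps_const x * E)) n =
      degen_exp lam y x *
      (\<Sum>k=0..n. fact n * (((y / lam) gchoose k) *
        ((lam * x / c) ^ k * fps_nth ((E - 1) ^ k) n)))"
    unfolding degen_exp_fps_def fps_powr_def F0 G
    by (simp add: fps_compose_nth power_mult_distrib fps_const_power degen_exp_def c_def
        sum_distrib_left mult_ac)
  \<comment> \<open>The factor \<open>lam ^ k\<close> turns the binomial coefficient into the
    falling factorial; the \<open>fact k\<close> this costs cancels the one in the Stirling
    number.\<close>
  also have "(\<Sum>k=0..n. fact n * (((y / lam) gchoose k) *
        ((lam * x / c) ^ k * fps_nth ((E - 1) ^ k) n))) =
      (\<Sum>k=0..n. degen_stirling2 lam n k * degen_ffact lam y k * (x / c) ^ k)"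
    using assms(1)
    by (intro sum.cong)
      (simp_all add: degen_stirling2_eq degen_ffact_eq_gbinomial E_def power_mult_distrib
        power_divide mult_ac)
  finally show ?thesis by (simp add: E_def c_def)
qed

text \<open>Dividing by the constant \<open>degen_exp lam 1 x\<close> lowers the exponent of the
  prefactor from \<open>y\<close> to \<open>y - 1\<close>.\<close>

lemma fdegen_bell2_eq:
  assumes "lam \<noteq> 0" and "1 + lam * x > 0"
  shows "fdegen_bell2 lam n x y =
    degen_exp lam (y - 1) x *
    (\<Sum>k=0..n. degen_stirling2 lam n k * degen_ffact lam y k * (x / (1 + lam * x)) ^ k)"
proof -
  have "degen_exp lam 1 x \<noteq> 0"
    using assms by (simp add: degen_exp_def)
  then have "fdegen_bell2 lam n x y =
      fact n * fps_nth (degen_exp_fps lam y (fps_const x * degen_exp_fps lam 1 fps_X)) n /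
      degen_exp lam 1 x"
    by (simp add: fdegen_bell2_def fps_divide_unit fps_const_inverse divide_inverse)
  then show ?thesis
    using assms by (simp add: degen_exp_fps_compose_nth degen_exp_diff [symmetric])
qed

theorem theorem2p5:
  fixes lam x y :: real and n :: nat
  assumes "lam \<noteq> 0" and "1 + lam * x > 0"
  shows "fdegen_bell2 lam n x y =
           degen_exp lam (y - 1) x *
           (\<Sum>k=0..n. degen_stirling2 lam n k * degen_ffact lam y k * (x / (1 + lam * x)) ^ k) \<and>
         fdegen_bell2 lam n x 1 =
           (\<Sum>k=0..n. degen_stirling2 lam n k * degen_ffact lam 1 k * (x / (1 + lam * x)) ^ k) \<and>
         (\<Sum>k=0..n. degen_stirling2 lam n k * degen_ffact lam 1 k * (x / (1 + lam * x)) ^ k) =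
           fdegen_bell lam n x"
proof -
  \<comment> \<open>Positivity of the base matters here, since \<open>0 powr 0 = 0\<close>.\<close>
  have "degen_exp lam (1 - 1) x = 1"
    using assms by (simp add: degen_exp_def)
  then have one: "fdegen_bell2 lam n x 1 =
      (\<Sum>k=0..n. degen_stirling2 lam n k * degen_ffact lam 1 k * (x / (1 + lam * x)) ^ k)"
    using fdegen_bell2_eq [OF assms, of n 1] by simp
  have "fdegen_bell2 lam n x 1 = fdegen_bell lam n x"
    by (simp only: fdegen_bell_def fdegen_bell2_def)
  then show ?thesis
    using fdegen_bell2_eq [OF assms] one by simp
qed

end
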